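(* For every odd integer $n\ge5$, each of the polynomials $\mathsf{DExc}_n^{+}(t)$ and $\mathsf{DExc}_n^{-}(t)$ can be written as a sum of two gamma positive polynomials.
   Context: $\mathfrak{B}_n$ is the group of signed permutations of $\{\pm1,\dots,\pm n\}$ ($\pi(-i)=-\pi(i)$), $\pi_i=\pi(i)$, and $\mathfrak{D}_n\subseteq\mathfrak{B}_n$ consists of those $\pi$ with an even number of negative entries among $\pi_1,\dots,\pi_n$. For $\pi\in\mathfrak{D}_n$, $\mathsf{inv}_D(\pi)=|\{1\le i<j\le n:\pi_i>\pi_j\}|+|\{1\le i<j\le n:-\pi_i>\pi_j\}|$; $\mathfrak{D}_n^{+}=\{\pi\in\mathfrak{D}_n:\mathsf{inv}_D(\pi)\text{ even}\}$, $\mathfrak{D}_n^{-}=\mathfrak{D}_n\setminus\mathfrak{D}_n^{+}$. $\mathsf{exc}_D(\pi)=|\{i\in[n]:\pi(|\pi(i)|)>\pi(i)\}|+|\{i\in[n]:\pi_i=-i\}|$ and $\mathsf{DExc}_n^{\pm}(t)=\sum_{\pi\in\mathfrak{D}_n^{\pm}}t^{\mathsf{exc}_D(\pi)}$. A univariate $f(t)=\sum_{i=0}^Na_it^i$ ($a_N\ne0$, $r$ least with $a_r\neq0$) is gamma positive if it is palindromic ($a_{r+i}=a_{N-i}$) and $f(t)=\sum_{i=0}^{\lfloor(N-r)/2\rfloor}\gamma_it^{r+i}(1+t)^{N-r-2i}$ with all $\gamma_i\ge0$. *)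

theory Defs
  imports "HOL-Computational_Algebra.Polynomial" "HOL-Combinatorics.Permutations"
begin

(* A signed permutation of {-n,...,-1,1,...,n} is a function on int that permutes this set,
   fixes every other integer and is odd. *)
definition signed_perms :: "nat \<Rightarrow> (int \<Rightarrow> int) set" where
  "signed_perms n = {\<pi>. \<pi> permutes ({- int n..int n} - {0}) \<and> (\<forall>i. \<pi> (- i) = - \<pi> i)}"

lemma finite_signed_perms: "finite (signed_perms n)"
  by (rule finite_subset[OF _ finite_permutations[of "{- int n..int n} - {0}"]])
     (auto simp: signed_perms_def)

definition perms_D :: "nat \<Rightarrow> (int \<Rightarrow> int) set" where
  "perms_D n = {\<pi> \<in> signed_perms n. even (card {i \<in> {1..int n}. \<pi> i < 0})}"

definition inv_D :: "nat \<Rightarrow> (int \<Rightarrow> int) \<Rightarrow> nat" where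
  "inv_D n \<pi> =
     card {(i, j). 1 \<le> i \<and> i < j \<and> j \<le> int n \<and> \<pi> i > \<pi> j} +
     card {(i, j). 1 \<le> i \<and> i < j \<and> j \<le> int n \<and> - \<pi> i > \<pi> j}"

definition perms_D_plus :: "nat \<Rightarrow> (int \<Rightarrow> int) set" where
  "perms_D_plus n = {\<pi> \<in> perms_D n. even (inv_D n \<pi>)}"

definition perms_D_minus :: "nat \<Rightarrow> (int \<Rightarrow> int) set" where
  "perms_D_minus n = perms_D n - perms_D_plus n"

definition exc_D :: "nat \<Rightarrow> (int \<Rightarrow> int) \<Rightarrow> nat" where
  "exc_D n \<pi> =
     card {i \<in> {1..int n}. \<pi> \<bar>\<pi> i\<bar> > \<pi> i} +
     card {i \<in> {1..int n}. \<pi> i = - i}"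

definition DExc_plus :: "nat \<Rightarrow> real poly" where
  "DExc_plus n = (\<Sum>\<pi>\<in>perms_D_plus n. monom 1 (exc_D n \<pi>))"

definition DExc_minus :: "nat \<Rightarrow> real poly" where
  "DExc_minus n = (\<Sum>\<pi>\<in>perms_D_minus n. monom 1 (exc_D n \<pi>))"

definition low_degree :: "real poly \<Rightarrow> nat" where
  "low_degree f = (LEAST i. coeff f i \<noteq> 0)"

definition palindromic :: "real poly \<Rightarrow> bool" where
  "palindromic f \<longleftrightarrow>
     (\<forall>i \<le> degree f - low_degree f. coeff f (low_degree f + i) = coeff f (degree f - i))"

(* The zero polynomial is excluded: the leading coefficient is required to be nonzero. *)
definition gamma_positive :: "real poly \<Rightarrow> bool" where
  "gamma_positive f \<longleftrightarrow> f \<noteq> 0 \<and> palindromic f \<and>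
     (let N = degree f; r = low_degree f in
      \<exists>\<gamma> :: nat \<Rightarrow> real.
        (\<forall>i \<le> (N - r) div 2. \<gamma> i \<ge> 0) \<and>
        f = (\<Sum>i\<le>(N - r) div 2. monom (\<gamma> i) (r + i) * [:1, 1:] ^ (N - r - 2 * i)))"

end

theory Submission
  imports Defs
begin

text \<open>
  A signed permutation is determined by the permutation \<open>\<sigma> = \<bar>\<pi>\<bar>\<close> of \<open>[n]\<close> and the set \<open>s\<close> of values that
  occur negated. The parity of \<open>inv\<^sub>D\<close> is the sign of \<open>\<sigma>\<close>, and \<open>exc\<^sub>D\<close> counts the excedances of \<open>\<sigma>\<close>
  with respect to the order on \<open>[n]\<close> obtained by negating the elements of \<open>s\<close>, plus the fixed
  points in \<open>s\<close>. The distribution of excedances does not depend on the chosen order, so the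
  four sums over all signed permutations weighted by \<open>(\<plusminus>1)\<^bsup>|s|\<^esup>\<close> and an optional sign of \<open>\<sigma>\<close> are binomial
  transforms of Eulerian polynomials. Three of them are elementary; the fourth is the
  type B Eulerian polynomial \<open>B\<^sub>n(t)\<close>. For \<open>n = 2m + 1\<close>, with \<open>B\<^sub>n = (1 + t) Q\<close> and \<open>P = (1 - t)\<^bsup>2m\<^esup>\<close>,
  this gives \<open>4 DExc\<^sup>+ = (Q + 3 P) + t (Q - P)\<close> and \<open>4 DExc\<^sup>- = (1 + t) (Q - P)\<close>. The \<open>i\<close>-th gamma
  coefficient of \<open>Q\<close> is \<open>4\<^sup>i\<close> times the number of permutations with \<open>i\<close> left peaks, and that of \<open>P\<close>
  is \<open>(-4)\<^sup>i\<close> times a binomial coefficient; the former dominates three times the latter for \<open>i > 0\<close>.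
\<close>

subsection \<open>The sign of a permutation as parity of inversions\<close>

definition inversions :: "'a::linorder set \<Rightarrow> ('a \<Rightarrow> 'a) \<Rightarrow> ('a \<times> 'a) set" where
  "inversions K \<sigma> = {(i, j). i \<in> K \<and> j \<in> K \<and> i < j \<and> \<sigma> i > \<sigma> j}"

text \<open>The inverted pairs are \<open>(a, j)\<close> with \<open>a < j \<le> b\<close> and
  \<open>(i, b)\<close> with \<open>a < i < b\<close>, so there are 2(b - a) - 1 of them.\<close>

lemma card_inversions_transpose:
  fixes a b :: int
  assumes "l \<le> a" "a < b" "b \<le> u"
  shows "odd (card (inversions {l..u} (Transposition.transpose a b)))"
proof -
  have "inversions {l..u} (Transposition.transpose a b) =
    {a} \<times> {a<..b} \<union> {a<..<b} \<times> {b}"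
    using assms by (auto simp: inversions_def Transposition.transpose_def split: if_splits)
  moreover have "card ({a} \<times> {a<..b} \<union> {a<..<b} \<times> {b}) = nat (b - a) + nat (b - a - 1)"
    by (subst card_Un_disjoint) auto
  ultimately show ?thesis
    using assms by (auto simp: even_nat_iff nat_add_distrib[symmetric])
qed

text \<open>A pair is inverted by \<open>\<sigma> \<circ> \<tau>\<close> iff either
  \<open>\<tau>\<close> inverts it or \<open>\<sigma>\<close> inverts its sorted image under
  \<open>\<tau>\<close>, but not both. Taking the product of the corresponding signs over all pairs
  gives the claim, because \<open>\<tau>\<close> permutes the two-element subsets of
  \<open>K\<close>.\<close>

lemma even_card_inversions_compose:
  fixes \<sigma> \<tau> :: "'a::linorder \<Rightarrow> 'a"
  assumes K: "finite K" and \<sigma>: "\<sigma> permutes K" and \<tau>: "\<tau> permutes K"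
  shows "even (card (inversions K (\<sigma> \<circ> \<tau>))) \<longleftrightarrow>
    (even (card (inversions K \<sigma>)) \<longleftrightarrow> even (card (inversions K \<tau>)))"
proof -
  define P where "P = {(i, j). i \<in> K \<and> j \<in> K \<and> i < j}"
  \<comment> \<open>\<open>g\<close> agrees with \<open>h \<sigma>\<close> on increasing pairs but
    takes the same value at \<open>(i, j)\<close> and \<open>(j, i)\<close>, so sorting the image of
    a pair does not affect it.\<close>
  define g :: "'a \<times> 'a \<Rightarrow> int" where
    "g = (\<lambda>(i, j). if i < j \<longleftrightarrow> \<sigma> i < \<sigma> j then 1 else -1)"
  define h where "h \<rho> = (\<lambda>(i, j). if \<rho> i < \<rho> j then 1 else (-1::int))" for \<rho> :: "'a \<Rightarrow> 'a"
  have fP: "finite P"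
    by (rule finite_subset[of _ "K \<times> K"]) (auto simp: P_def K)
  have V: "(\<Prod>p\<in>P. h \<rho> p) = (-1) ^ card (inversions K \<rho>)" if "\<rho> permutes K" for \<rho>
  proof -
    have "(\<Prod>p\<in>P. h \<rho> p) = (\<Prod>p\<in>P. if p \<in> inversions K \<rho> then -1 else 1)"
      using permutes_inj[OF that]
      by (intro prod.cong) (force simp: P_def inversions_def h_def not_less order.order_iff_strict inj_eq)+
    also have "\<dots> = (-1) ^ card (inversions K \<rho>)"
      by (subst prod.inter_restrict[symmetric, OF fP])
        (auto simp: inversions_def P_def intro!: arg_cong[where f = "\<lambda>X. (-1) ^ card X"])
    finally show ?thesis .
  qed
  have inj: "\<tau> i = \<tau> j \<longleftrightarrow> i = j" "\<sigma> i = \<sigma> j \<longleftrightarrow> i = j" for i j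
    using permutes_inj[OF \<sigma>] permutes_inj[OF \<tau>] by (auto simp: inj_eq)
  \<comment> \<open>The action of a permutation on two-element sets, each represented by its
    increasing pair.\<close>
  define q where "q \<rho> = (\<lambda>(i, j). (min (\<rho> i) (\<rho> j), max (\<rho> i) (\<rho> j)))" for \<rho> :: "'a \<Rightarrow> 'a"
  have qq: "q \<rho> p \<in> P" "q \<rho>' (q \<rho> p) = p" if "\<rho> permutes K" "\<rho>' \<circ> \<rho> = id" "p \<in> P" for \<rho> \<rho>' p
  proof -
    have *: "\<rho>' (\<rho> x) = x" for x using that(2) by (metis comp_apply id_apply)
    have **: "\<rho> x = \<rho> y \<longleftrightarrow> x = y" for x y
      using permutes_inj[OF that(1)] by (simp add: inj_eq)
    obtain i j where p: "p = (i, j)" "i \<in> K" "j \<in> K" "i < j"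
      using \<open>p \<in> P\<close> by (auto simp: P_def)
    have "\<rho> i \<in> K" "\<rho> j \<in> K" "\<rho> i < \<rho> j \<or> \<rho> j < \<rho> i"
      using p permutes_in_image[OF that(1)] **[of i j] by auto
    then show "q \<rho> p \<in> P"
      by (auto simp: P_def q_def min_def max_def p(1))
    show "q \<rho>' (q \<rho> p) = p"
      using that(3) by (auto simp: P_def q_def min_def max_def *)
  qed
  have "(\<Prod>p\<in>P. h \<sigma> p) = (\<Prod>p\<in>P. g p)"
    by (intro prod.cong) (auto simp: P_def g_def h_def)
  also have "\<dots> = (\<Prod>p\<in>P. g (q \<tau> p))"
    using qq[OF permutes_inv[OF \<tau>] permutes_inv_o(1)[OF \<tau>]] qq[OF \<tau> permutes_inv_o(2)[OF \<tau>]]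
    by (intro prod.reindex_bij_witness[of _ "q \<tau>" "q (inv \<tau>)"]) auto
  also have "\<dots> = (\<Prod>p\<in>P. h (\<sigma> \<circ> \<tau>) p * h \<tau> p)"
    by (intro prod.cong) (auto simp: P_def g_def h_def q_def min_def max_def not_less
        order.order_iff_strict inj)
  finally have "(\<Prod>p\<in>P. h \<sigma> p) = (\<Prod>p\<in>P. h (\<sigma> \<circ> \<tau>) p) * (\<Prod>p\<in>P. h \<tau> p)"
    by (simp add: prod.distrib)
  then have "(-1::int) ^ card (inversions K \<sigma>) =
      (-1) ^ card (inversions K (\<sigma> \<circ> \<tau>)) * (-1) ^ card (inversions K \<tau>)"
    by (simp only: V \<sigma> \<tau> permutes_compose)
  then show ?thesis
    by (auto simp: minus_one_power_iff split: if_splits)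
qed

text \<open>Both parities flip under composition with a transposition, and transpositions generate
  all permutations of a finite set.\<close>

lemma evenperm_iff_inversions:
  fixes \<sigma> :: "int \<Rightarrow> int"
  assumes "\<sigma> permutes {l..u}"
  shows "evenperm \<sigma> \<longleftrightarrow> even (card (inversions {l..u} \<sigma>))"
  using assms finite_atLeastAtMost_int[of l u]
proof (induction rule: permutes_induct)
  case id
  have "inversions {l..u} (id :: int \<Rightarrow> int) = {}" by (auto simp: inversions_def)
  then show ?case by (metis card.empty even_zero evenperm_id)
next
  case (swap a b p)
  have t: "Transposition.transpose a b permutes {l..u}"
    using swap by (intro permutes_swap_id) auto
  have "odd (card (inversions {l..u} (Transposition.transpose a b)))"
    using swap card_inversions_transpose[of l a b u] card_inversions_transpose[of l b a u]
    by (cases "a < b") (auto simp: transpose_commute)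
  then show ?case
    using swap t even_card_inversions_compose[OF _ t, of p]
    by (subst evenperm_comp)
      (auto simp: evenperm_swap intro: permutation_permutes[THEN iffD2])
qed

subsection \<open>Excedances\<close>

lemma smult_sum_right: "smult c (\<Sum>i\<in>A. f i) = (\<Sum>i\<in>A. smult c (f i))"
  by (induction A rule: infinite_finite_induct) (simp_all add: smult_add_right)

text \<open>The parameter \<open>e\<close> selects the weight: the sign of each permutation is taken to the power \<open>e\<close>,
  so \<open>e = 0\<close> gives the Eulerian polynomial and \<open>e = 1\<close> its signed version.\<close>

fun eulerian :: "nat \<Rightarrow> nat \<Rightarrow> real poly" where
  "eulerian e 0 = 1"
| "eulerian e (Suc k) = (1 + smult ((-1) ^ e) (monom (real k) 1)) * eulerian e k
     + smult ((-1) ^ e) ([:0, 1, -1:] * pderiv (eulerian e k))"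

text \<open>Inserting a new maximum into a cycle right after \<open>c\<close> makes \<open>c\<close> an excedance
  and changes nothing else; here \<open>E\<close> is the set of excedances before the insertion.\<close>

lemma excedance_sum_step:
  fixes \<chi> :: real
  assumes "finite S" "E \<subseteq> S"
  shows "(\<Sum>c\<in>S. monom \<chi> (if c \<in> E then card E else Suc (card E))) =
    monom (real (card S)) 1 * monom \<chi> (card E) + [:0, 1, -1:] * pderiv (monom \<chi> (card E))"
proof -
  have fE: "finite E" using assms by (rule finite_subset[rotated])
  have "(\<Sum>c\<in>S. monom \<chi> (if c \<in> E then card E else Suc (card E))) =
    (\<Sum>c\<in>E. monom \<chi> (card E)) + (\<Sum>c\<in>S-E. monom \<chi> (Suc (card E)))"
    using assms fE by (subst sum.subset_diff[of E S]) (auto simp: add.commute intro!: arg_cong2[where f = "(+)"] sum.cong)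
  also have "\<dots> = monom (real (card E) * \<chi>) (card E) +
      monom ((real (card S) - real (card E)) * \<chi>) (Suc (card E))"
    using assms fE
    by (simp add: card_Diff_subset of_nat_diff card_mono of_nat_poly mult.commute
        smult_monom flip: of_nat_diff)
  also have "\<dots> = monom (real (card S)) 1 * monom \<chi> (card E) + [:0, 1, -1:] * pderiv (monom \<chi> (card E))"
  proof (cases "card E")
    case 0
    then show ?thesis by (simp add: pderiv_monom mult_monom)
  next
    case (Suc k)
    have "[:0, 1, -1:] = monom (1::real) 1 - monom 1 2"
      by (simp add: monom_altdef power2_eq_square)
    then show ?thesis using Suc
      unfolding \<open>[:0, 1, -1:] = _\<close>
      by (simp only: pderiv_monom mult_monom left_diff_distrib) (simp add: diff_monom add_monom algebra_simps)
  qed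
  finally show ?thesis .
qed

text \<open>Elements are inserted in increasing order of \<open>v\<close>, so each new one is the
  maximum and \<open>excedance_sum_step\<close> applies. The result depends on \<open>K\<close> only
  through its size, which later permits a different order for every set of negated values.\<close>

lemma excedance_sum:
  fixes v :: "'a \<Rightarrow> 'b::linorder"
  assumes "finite K" "inj_on v K"
  shows "(\<Sum>\<sigma> | \<sigma> permutes K. monom (of_int (sign \<sigma> ^ e)) (card {j \<in> K. v j < v (\<sigma> j)})) =
    eulerian e (card K)"
  using assms
proof (induction K rule: finite_ranking_induct[of _ _ v])
  case empty
  then show ?case by simp
next
  case (insert a S)
  show ?case
  proof (cases "a \<in> S")
    case True
    then show ?thesis using insert by (simp add: insert_absorb)
  next
    case False
    define x where "x \<sigma> = card {j \<in> S. v j < v (\<sigma> j)}" for \<sigma>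
    define w where "w \<sigma> = (of_int (sign \<sigma> ^ e) :: real)" for \<sigma> :: "'a \<Rightarrow> 'a"
    have less: "v j < v a" if "j \<in> S" for j
      using insert.hyps(2)[OF that] insert.prems False that by (auto simp: inj_on_def order.order_iff_strict)
    have IH: "(\<Sum>\<sigma> | \<sigma> permutes S. monom (w \<sigma>) (x \<sigma>)) = eulerian e (card S)"
      unfolding w_def x_def using insert.IH insert.prems by auto
    have fixed: "monom (w \<sigma>) (card {j \<in> insert a S. v j < v (\<sigma> j)}) = monom (w \<sigma>) (x \<sigma>)"
      if "\<sigma> permutes S" for \<sigma>
    proof -
      have "{j \<in> insert a S. v j < v (\<sigma> j)} = {j \<in> S. v j < v (\<sigma> j)}"
        using False permutes_not_in[OF that] by auto
      then show ?thesis by (simp add: x_def)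
    qed
    have fixed_sum: "(\<Sum>\<sigma> | \<sigma> permutes S. monom (w \<sigma>) (card {j \<in> insert a S. v j < v (\<sigma> j)})) =
        (\<Sum>\<sigma> | \<sigma> permutes S. monom (w \<sigma>) (x \<sigma>))"
      by (intro sum.cong) (simp_all only: mem_Collect_eq fixed)
    \<comment> \<open>The composite sends \<open>c\<close> to the maximum \<open>a\<close> and
      \<open>a\<close> to the old \<open>\<sigma> c\<close>, so \<open>c\<close> becomes an
      excedance and \<open>a\<close> is none. The extra transposition flips the sign.\<close>
    have moved: "monom (w (Transposition.transpose a (\<sigma> c) \<circ> \<sigma>))
        (card {j \<in> insert a S. v j < v ((Transposition.transpose a (\<sigma> c) \<circ> \<sigma>) j)}) =
        smult ((-1) ^ e) (monom (w \<sigma>) (if c \<in> {j \<in> S. v j < v (\<sigma> j)} then x \<sigma> else Suc (x \<sigma>)))"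
      if \<sigma>: "\<sigma> permutes S" and c: "c \<in> S" for \<sigma> c
    proof -
      let ?\<tau> = "Transposition.transpose a (\<sigma> c) \<circ> \<sigma>"
      have \<sigma>c: "\<sigma> c \<in> S" using \<sigma> c by (simp add: permutes_in_image)
      have "{j \<in> insert a S. v j < v (?\<tau> j)} = insert c {j \<in> S. v j < v (\<sigma> j)}"
        using False \<sigma>c c less permutes_not_in[OF \<sigma> False] permutes_inj[OF \<sigma>] permutes_in_image[OF \<sigma>]
        by (auto simp: Transposition.transpose_def inj_eq dest: less_asym split: if_splits)
      then have "card {j \<in> insert a S. v j < v (?\<tau> j)} =
          (if c \<in> {j \<in> S. v j < v (\<sigma> j)} then x \<sigma> else Suc (x \<sigma>))"
        using insert.hyps(1) by (simp add: card_insert_if x_def)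
      moreover have "sign ?\<tau> = - sign \<sigma>"
        using \<sigma>c False permutation_permutes insert.hyps(1) \<sigma>
        by (subst sign_compose) (auto simp: sign_swap_id permutation_swap_id)
      ultimately show ?thesis
        by (simp add: w_def smult_monom power_minus[of "of_int (sign \<sigma>)"])
    qed
    have "(\<Sum>\<sigma> | \<sigma> permutes insert a S. monom (w \<sigma>) (card {j \<in> insert a S. v j < v (\<sigma> j)})) =
      (\<Sum>\<sigma> | \<sigma> permutes S. monom (w \<sigma>) (x \<sigma>)) +
      (\<Sum>b\<in>S. \<Sum>\<sigma> | \<sigma> permutes S. monom (w (Transposition.transpose a b \<circ> \<sigma>))
         (card {j \<in> insert a S. v j < v ((Transposition.transpose a b \<circ> \<sigma>) j)}))"
      by (simp only: sum_over_permutations_insert[OF insert.hyps(1) False] fixed_sum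
          sum.insert[OF insert.hyps(1) False] transpose_same id_comp)
    also have "(\<Sum>b\<in>S. \<Sum>\<sigma> | \<sigma> permutes S. monom (w (Transposition.transpose a b \<circ> \<sigma>))
         (card {j \<in> insert a S. v j < v ((Transposition.transpose a b \<circ> \<sigma>) j)})) =
       (\<Sum>\<sigma> | \<sigma> permutes S. \<Sum>b\<in>S. monom (w (Transposition.transpose a b \<circ> \<sigma>))
         (card {j \<in> insert a S. v j < v ((Transposition.transpose a b \<circ> \<sigma>) j)}))"
      by (rule sum.swap)
    also have "\<dots> = (\<Sum>\<sigma> | \<sigma> permutes S. \<Sum>c\<in>S. smult ((-1) ^ e)
         (monom (w \<sigma>) (if c \<in> {j \<in> S. v j < v (\<sigma> j)} then x \<sigma> else Suc (x \<sigma>))))"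
    proof (rule sum.cong)
      fix \<sigma> assume "\<sigma> \<in> {\<sigma>. \<sigma> permutes S}"
      then have \<sigma>: "\<sigma> permutes S" by simp
      let ?G = "\<lambda>b. monom (w (Transposition.transpose a b \<circ> \<sigma>))
         (card {j \<in> insert a S. v j < v ((Transposition.transpose a b \<circ> \<sigma>) j)})"
      \<comment> \<open>Substituting \<open>b = \<sigma> c\<close> turns the sum over transpositions
        into a sum over the element \<open>c\<close> behind which \<open>a\<close> is
        inserted.\<close>
      have "sum ?G S = (\<Sum>c\<in>S. ?G (\<sigma> c))"
        by (rule sum.reindex_bij_betw[OF permutes_imp_bij[OF \<sigma>], symmetric])
      also have "\<dots> = (\<Sum>c\<in>S. smult ((-1) ^ e)
         (monom (w \<sigma>) (if c \<in> {j \<in> S. v j < v (\<sigma> j)} then x \<sigma> else Suc (x \<sigma>))))"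
        by (rule sum.cong[OF refl moved[OF \<sigma>]])
      finally show "sum ?G S = (\<Sum>c\<in>S. smult ((-1) ^ e)
         (monom (w \<sigma>) (if c \<in> {j \<in> S. v j < v (\<sigma> j)} then x \<sigma> else Suc (x \<sigma>))))" .
    qed simp
    also have "\<dots> = (\<Sum>\<sigma> | \<sigma> permutes S. smult ((-1) ^ e)
        (monom (real (card S)) 1 * monom (w \<sigma>) (x \<sigma>) + [:0, 1, -1:] * pderiv (monom (w \<sigma>) (x \<sigma>))))"
      unfolding x_def smult_sum_right[symmetric]
      by (intro sum.cong refl arg_cong[where f = "smult _"] excedance_sum_step insert.hyps) auto
    also have "\<dots> = smult ((-1) ^ e)
        (monom (real (card S)) 1 * eulerian e (card S) + [:0, 1, -1:] * pderiv (eulerian e (card S)))"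
      by (simp only: IH[symmetric] smult_sum_right sum_distrib_left sum.distrib higher_pderiv_sum[where n = 1, simplified] smult_add_right)
    finally show ?thesis
      unfolding IH unfolding w_def using insert.hyps(1) False
      by (simp add: smult_add_right algebra_simps)
  qed
qed

subsection \<open>Signed permutations\<close>

lemma power_card_eq_sum_Pow:
  fixes y :: "'a::comm_semiring_1"
  assumes "finite X"
  shows "(y + 1) ^ card X = (\<Sum>F\<in>Pow X. y ^ card F)"
  using prod_add[OF assms, of "\<lambda>_. y" "\<lambda>_. 1"] by simp

lemma sum_Pow_card:
  fixes h :: "nat \<Rightarrow> 'a::comm_semiring_1"
  assumes "finite K"
  shows "(\<Sum>F\<in>Pow K. h (card F)) = (\<Sum>k\<le>card K. of_nat (card K choose k) * h k)"
proof -
  have "(\<Sum>F\<in>Pow K. h (card F)) =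
      (\<Sum>k\<le>card K. \<Sum>F | F \<in> Pow K \<and> card F = k. h (card F))"
    using assms by (intro sum.group[symmetric]) (auto intro: card_mono)
  also have "\<dots> = (\<Sum>k\<le>card K. of_nat (card K choose k) * h k)"
    by (intro sum.cong refl) (simp add: n_subsets[OF assms, symmetric])
  finally show ?thesis .
qed

lemma sum_supersets_power_card:
  fixes x :: "'a::comm_semiring_1"
  assumes "finite K" "F \<subseteq> K"
  shows "(\<Sum>s | s \<in> Pow K \<and> F \<subseteq> s. x ^ card s) = x ^ card F * (x + 1) ^ card (K - F)"
proof -
  have fin: "finite F" "finite (K - F)"
    using assms by (auto intro: finite_subset)
  have "(\<Sum>s | s \<in> Pow K \<and> F \<subseteq> s. x ^ card s) = (\<Sum>r\<in>Pow (K - F). x ^ card (F \<union> r))"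
    using assms by (intro sum.reindex_bij_witness[of _ "\<lambda>r. F \<union> r" "\<lambda>s. s - F"])
      (auto simp: Un_absorb1)
  also have "\<dots> = (\<Sum>r\<in>Pow (K - F). x ^ card F * x ^ card r)"
    using fin by (intro sum.cong refl, subst card_Un_disjoint) (auto simp: power_add intro: finite_subset)
  finally show ?thesis
    by (simp add: power_card_eq_sum_Pow[OF fin(2)] sum_distrib_left)
qed

definition signed_value :: "int set \<Rightarrow> int \<Rightarrow> int" where
  "signed_value s j = (if j \<in> s then - j else j)"

lemma inj_on_signed_value: "K \<subseteq> {0<..} \<Longrightarrow> inj_on (signed_value s) K"
  by (rule inj_onI, frule (1) subsetD[of K "{0<..}"], drule (1) subsetD[of K "{0<..}"])
    (auto simp: signed_value_def split: if_splits)

text \<open>Expanding \<open>t\<close> to the number of fixed points in \<open>s\<close> as a sum of powers of \<open>t - 1\<close> over sets \<open>F\<close>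
  of fixed points reduces the claim to unrestricted permutations of \<open>K - F\<close>.\<close>

lemma excedance_sum_fixed:
  fixes v :: "'a \<Rightarrow> 'b::linorder"
  assumes K: "finite K" "inj_on v K" and "s \<subseteq> K"
  shows "(\<Sum>\<sigma> | \<sigma> permutes K. monom (of_int (sign \<sigma> ^ e))
      (card {j \<in> K. v j < v (\<sigma> j)} + card {j \<in> s. \<sigma> j = j})) =
    (\<Sum>F\<in>Pow s. [:-1, 1:] ^ card F * eulerian e (card K - card F))"
proof -
  let ?w = "\<lambda>\<sigma>. monom (of_int (sign \<sigma> ^ e) :: real) (card {j \<in> K. v j < v (\<sigma> j)})"
  have fs: "finite s" using K(1) \<open>s \<subseteq> K\<close> by (rule finite_subset[rotated])
  have mono: "monom c (a + card X) = monom c a * (\<Sum>F\<in>Pow X. [:-1, 1:] ^ card F)"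
    if "finite X" for c :: real and a X
    using power_card_eq_sum_Pow[OF that, of "[:-1, 1:] :: real poly"]
    by (simp add: one_pCons flip: monom_altdef) (simp add: monom_altdef power_add)
  have "(\<Sum>\<sigma> | \<sigma> permutes K. monom (of_int (sign \<sigma> ^ e))
      (card {j \<in> K. v j < v (\<sigma> j)} + card {j \<in> s. \<sigma> j = j})) =
    (\<Sum>\<sigma> | \<sigma> permutes K. \<Sum>F | F \<in> Pow s \<and> (\<forall>j\<in>F. \<sigma> j = j). ?w \<sigma> * [:-1, 1:] ^ card F)"
    using fs by (subst mono) (auto simp: sum_distrib_left intro!: sum.cong)
  also have "\<dots> = (\<Sum>F\<in>Pow s. \<Sum>\<sigma> | \<sigma> \<in> {\<sigma>. \<sigma> permutes K} \<and> (\<forall>j\<in>F. \<sigma> j = j).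
      ?w \<sigma> * [:-1, 1:] ^ card F)"
    using fs K(1) finite_permutations[OF K(1)] by (intro sum.swap_restrict) auto
  also have "\<dots> = (\<Sum>F\<in>Pow s. [:-1, 1:] ^ card F * eulerian e (card K - card F))"
  proof (rule sum.cong)
    fix F assume "F \<in> Pow s"
    then have F: "F \<subseteq> K" "finite F" using \<open>s \<subseteq> K\<close> fs by (auto intro: finite_subset)
    have "{\<sigma>. \<sigma> \<in> {\<sigma>. \<sigma> permutes K} \<and> (\<forall>j\<in>F. \<sigma> j = j)} = {\<sigma>. \<sigma> permutes (K - F)}"
    proof (intro equalityI subsetI)
      fix \<sigma> assume "\<sigma> \<in> {\<sigma>. \<sigma> \<in> {\<sigma>. \<sigma> permutes K} \<and> (\<forall>j\<in>F. \<sigma> j = j)}"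
      then show "\<sigma> \<in> {\<sigma>. \<sigma> permutes (K - F)}"
        by (auto intro: permutes_superset[of \<sigma> K])
    next
      fix \<sigma> assume "\<sigma> \<in> {\<sigma>. \<sigma> permutes (K - F)}"
      then have \<sigma>: "\<sigma> permutes (K - F)" by simp
      then show "\<sigma> \<in> {\<sigma>. \<sigma> \<in> {\<sigma>. \<sigma> permutes K} \<and> (\<forall>j\<in>F. \<sigma> j = j)}"
        using permutes_subset[OF \<sigma>, of K] permutes_not_in[OF \<sigma>] by auto
    qed
    then have "(\<Sum>\<sigma> | \<sigma> \<in> {\<sigma>. \<sigma> permutes K} \<and> (\<forall>j\<in>F. \<sigma> j = j). ?w \<sigma> * [:-1, 1:] ^ card F) =
        (\<Sum>\<sigma> | \<sigma> permutes (K - F). ?w \<sigma> * [:-1, 1:] ^ card F)"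
      by simp
    also have "\<dots> = (\<Sum>\<sigma> | \<sigma> permutes (K - F).
        monom (of_int (sign \<sigma> ^ e)) (card {j \<in> K - F. v j < v (\<sigma> j)}) * [:-1, 1:] ^ card F)"
    proof (rule sum.cong)
      fix \<sigma> assume "\<sigma> \<in> {\<sigma>. \<sigma> permutes (K - F)}"
      then have "{j \<in> K. v j < v (\<sigma> j)} = {j \<in> K - F. v j < v (\<sigma> j)}"
        using permutes_not_in[of \<sigma> "K - F"] by force
      then show "?w \<sigma> * [:-1, 1:] ^ card F =
        monom (of_int (sign \<sigma> ^ e)) (card {j \<in> K - F. v j < v (\<sigma> j)}) * [:-1, 1:] ^ card F"
        by simp
    qed simp
    also have "\<dots> = eulerian e (card (K - F)) * [:-1, 1:] ^ card F"
      using K excedance_sum[of "K - F" v e] by (simp add: inj_on_subset flip: sum_distrib_right)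
    finally show "(\<Sum>\<sigma> | \<sigma> \<in> {\<sigma>. \<sigma> permutes K} \<and> (\<forall>j\<in>F. \<sigma> j = j). ?w \<sigma> * [:-1, 1:] ^ card F) =
        [:-1, 1:] ^ card F * eulerian e (card K - card F)"
      using F by (simp add: card_Diff_subset mult.commute)
  qed simp
  finally show ?thesis .
qed

text \<open>For fixed \<open>s\<close>, \<open>excedance_sum_fixed\<close> gives a sum over subsets
  \<open>F\<close> of \<open>s\<close>. Exchanging the two sums leaves the sum of
  \<open>x ^ card s\<close> over all \<open>s\<close> containing \<open>F\<close>, and the result
  depends on \<open>F\<close> only through its size.\<close>

lemma signed_excedance_sum:
  fixes K :: "int set" and x :: real
  assumes K: "finite K" "K \<subseteq> {0<..}"
  shows "(\<Sum>\<sigma> | \<sigma> permutes K. \<Sum>s\<in>Pow K. monom (x ^ card s * of_int (sign \<sigma> ^ e))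
      (card {j \<in> K. signed_value s j < signed_value s (\<sigma> j)} + card {j \<in> s. \<sigma> j = j})) =
    (\<Sum>k\<le>card K. of_nat (card K choose k) *
      (smult (x ^ k * (x + 1) ^ (card K - k)) ([:-1, 1:] ^ k * eulerian e (card K - k))))"
    (is "?lhs = ?rhs")
proof -
  let ?A = "\<lambda>F. [:-1, 1:] ^ card F * eulerian e (card K - card F)"
  have "?lhs = (\<Sum>s\<in>Pow K. smult (x ^ card s) (\<Sum>\<sigma> | \<sigma> permutes K. monom (of_int (sign \<sigma> ^ e))
      (card {j \<in> K. signed_value s j < signed_value s (\<sigma> j)} + card {j \<in> s. \<sigma> j = j})))"
    by (subst sum.swap) (simp add: smult_sum_right smult_monom)
  also have "\<dots> = (\<Sum>s\<in>Pow K. \<Sum>F | F \<in> Pow K \<and> F \<subseteq> s. smult (x ^ card s) (?A F))"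
  proof (rule sum.cong)
    fix s assume s: "s \<in> Pow K"
    then have "{F. F \<in> Pow K \<and> F \<subseteq> s} = Pow s" by auto
    then show "smult (x ^ card s) (\<Sum>\<sigma> | \<sigma> permutes K. monom (of_int (sign \<sigma> ^ e))
      (card {j \<in> K. signed_value s j < signed_value s (\<sigma> j)} + card {j \<in> s. \<sigma> j = j})) =
      (\<Sum>F | F \<in> Pow K \<and> F \<subseteq> s. smult (x ^ card s) (?A F))"
      using s K excedance_sum_fixed[OF K(1) inj_on_signed_value[OF K(2), of s], where s = s and e = e]
      by (simp add: smult_sum_right)
  qed simp
  also have "\<dots> = (\<Sum>F\<in>Pow K. \<Sum>s | s \<in> Pow K \<and> F \<subseteq> s. smult (x ^ card s) (?A F))"
    using K by (intro sum.swap_restrict) auto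
  also have "\<dots> = (\<Sum>F\<in>Pow K. smult (\<Sum>s | s \<in> Pow K \<and> F \<subseteq> s. x ^ card s) (?A F))"
    by (simp add: smult_sum)
  also have "\<dots> = (\<Sum>F\<in>Pow K. smult (x ^ card F * (x + 1) ^ (card K - card F)) (?A F))"
  proof (rule sum.cong)
    fix F assume "F \<in> Pow K"
    then have "F \<subseteq> K" "finite F" using K by (auto intro: finite_subset)
    then show "smult (\<Sum>s | s \<in> Pow K \<and> F \<subseteq> s. x ^ card s) (?A F) =
        smult (x ^ card F * (x + 1) ^ (card K - card F)) (?A F)"
      using sum_supersets_power_card[OF K(1), of F x] by (simp add: card_Diff_subset)
  qed simp
  also have "\<dots> = ?rhs"
    by (rule sum_Pow_card[OF K(1)])
  finally show ?thesis .
qed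

section \<open>Signed permutations as pairs of a permutation and a set of negated values\<close>

definition signed_perm :: "(int \<Rightarrow> int) \<Rightarrow> int set \<Rightarrow> int \<Rightarrow> int" where
  "signed_perm \<sigma> s i = (if i < 0 then - signed_value s (\<sigma> (- i)) else signed_value s (\<sigma> i))"

lemma abs_signed_value [simp]: "\<bar>signed_value s j\<bar> = \<bar>j\<bar>"
  by (simp add: signed_value_def)

context
  fixes n :: nat and \<sigma> :: "int \<Rightarrow> int" and s :: "int set"
  assumes \<sigma>: "\<sigma> permutes {1..int n}" and s: "s \<subseteq> {1..int n}"
begin

private lemma \<sigma>_eq: "\<sigma> i = \<sigma> j \<longleftrightarrow> i = j"
  using permutes_inj[OF \<sigma>] by (simp add: inj_eq)

private lemma \<sigma>_range: "1 \<le> i \<Longrightarrow> i \<le> int n \<Longrightarrow> 1 \<le> \<sigma> i \<and> \<sigma> i \<le> int n"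
  using permutes_in_image[OF \<sigma>, of i] by simp

private lemma \<sigma>_outside: "\<not> (1 \<le> i \<and> i \<le> int n) \<Longrightarrow> \<sigma> i = i"
  using permutes_not_in[OF \<sigma>, of i] by simp

private lemma \<sigma>_nonneg: "0 \<le> i \<Longrightarrow> 0 \<le> \<sigma> i"
  using \<sigma>_range[of i] \<sigma>_outside[of i] by force

private lemma abs_signed_perm: "\<bar>signed_perm \<sigma> s i\<bar> = \<sigma> \<bar>i\<bar>"
  using \<sigma>_nonneg[of "\<bar>i\<bar>"] by (auto simp: signed_perm_def)

private lemma signed_perm_pos: "1 \<le> i \<Longrightarrow> signed_perm \<sigma> s i = signed_value s (\<sigma> i)"
  by (simp add: signed_perm_def)

private lemma signed_perm_uminus: "signed_perm \<sigma> s (- i) = - signed_perm \<sigma> s i"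
  using s \<sigma>_outside[of 0] by (auto simp: signed_perm_def signed_value_def)

lemma signed_perm_in_signed_perms: "signed_perm \<sigma> s \<in> signed_perms n"
proof -
  have "signed_perm \<sigma> s permutes ({- int n..int n} - {0})"
  proof (rule inj_imp_permutes)
    show "inj_on (signed_perm \<sigma> s) ({- int n..int n} - {0})"
    proof (rule inj_onI)
      fix i j assume i: "i \<in> {- int n..int n} - {0}" and eq: "signed_perm \<sigma> s i = signed_perm \<sigma> s j"
      from eq have "\<sigma> \<bar>i\<bar> = \<sigma> \<bar>j\<bar>" by (metis abs_signed_perm)
      then have "i = j \<or> j = - i" by (auto simp: \<sigma>_eq)
      \<comment> \<open>In the case \<open>j = - i\<close> the two images are opposite, so their
        equality would force the image to be 0.\<close>
      moreover have "signed_perm \<sigma> s i \<noteq> 0"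
      proof -
        have "1 \<le> \<bar>i\<bar>" "\<bar>i\<bar> \<le> int n" using i by auto
        then show ?thesis using abs_signed_perm[of i] \<sigma>_range[of "\<bar>i\<bar>"] by auto
      qed
      ultimately show "i = j" using eq signed_perm_uminus[of i] by auto
    qed
    fix i assume i: "i \<in> {- int n..int n} - {0}"
    then have "1 \<le> \<bar>signed_perm \<sigma> s i\<bar> \<and> \<bar>signed_perm \<sigma> s i\<bar> \<le> int n"
      unfolding abs_signed_perm by (intro \<sigma>_range) auto
    then show "signed_perm \<sigma> s i \<in> {- int n..int n} - {0}" by auto
  next
    fix i assume "i \<notin> {- int n..int n} - {0}"
    then show "signed_perm \<sigma> s i = i"
      using s \<sigma>_outside[of i] \<sigma>_outside[of "- i"] by (auto simp: signed_perm_def signed_value_def)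
  qed simp
  then show ?thesis
    by (simp add: signed_perms_def signed_perm_uminus)
qed

text \<open>One half of the bijection behind \<open>sum_signed_perms\<close>;
  \<open>signed_perm_surj\<close> is the other half, with the same two formulas.\<close>

lemma signed_perm_inverse:
  "(\<lambda>i. if i \<in> {1..int n} then \<bar>signed_perm \<sigma> s i\<bar> else i) = \<sigma>"
  "{j \<in> {1..int n}. \<exists>i\<in>{1..int n}. signed_perm \<sigma> s i = - j} = s"
proof -
  show "(\<lambda>i. if i \<in> {1..int n} then \<bar>signed_perm \<sigma> s i\<bar> else i) = \<sigma>"
    by (auto simp: fun_eq_iff abs_signed_perm \<sigma>_outside)
  have "(\<exists>i\<in>{1..int n}. signed_perm \<sigma> s i = - j) \<longleftrightarrow> j \<in> s" if j: "j \<in> {1..int n}" for j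
  proof
    assume "\<exists>i\<in>{1..int n}. signed_perm \<sigma> s i = - j"
    then show "j \<in> s"
      using j \<sigma>_range by (force simp: signed_perm_pos signed_value_def split: if_splits)
  next
    assume "j \<in> s"
    moreover obtain i where "i \<in> {1..int n}" "\<sigma> i = j"
      using j permutes_image[OF \<sigma>] by (metis imageE)
    ultimately show "\<exists>i\<in>{1..int n}. signed_perm \<sigma> s i = - j"
      by (intro bexI[of _ i]) (auto simp: signed_perm_pos signed_value_def)
  qed
  then show "{j \<in> {1..int n}. \<exists>i\<in>{1..int n}. signed_perm \<sigma> s i = - j} = s"
    using s by blast
qed

text \<open>The set \<open>s\<close> holds absolute values rather than positions;
  \<open>\<sigma>\<close> maps the negative positions bijectively onto it.\<close>

lemma card_negative_signed_perm: "card {i \<in> {1..int n}. signed_perm \<sigma> s i < 0} = card s"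
proof -
  have "bij_betw \<sigma> {i \<in> {1..int n}. signed_perm \<sigma> s i < 0} s"
  proof (rule bij_betwI')
    fix j assume "j \<in> s"
    moreover obtain i where "i \<in> {1..int n}" "\<sigma> i = j"
      using s \<open>j \<in> s\<close> permutes_image[OF \<sigma>] by (metis imageE subsetD)
    ultimately show "\<exists>i\<in>{i \<in> {1..int n}. signed_perm \<sigma> s i < 0}. j = \<sigma> i"
      using s by (intro bexI[of _ i]) (auto simp: signed_perm_pos signed_value_def)
  qed (use \<sigma>_range in \<open>force simp: \<sigma>_eq signed_perm_pos signed_value_def split: if_splits\<close>)+
  then show ?thesis by (rule bij_betw_same_card)
qed

text \<open>Put \<open>j = \<sigma> i\<close>, the absolute value of the image of \<open>i\<close>.
  The image of \<open>i\<close> is then the signed value of \<open>j\<close>, and the image of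
  \<open>j\<close> is the signed value of \<open>\<sigma> j\<close>, so the first count becomes one
  of excedances of \<open>\<sigma>\<close>.\<close>

lemma exc_D_signed_perm:
  "exc_D n (signed_perm \<sigma> s) =
    card {j \<in> {1..int n}. signed_value s j < signed_value s (\<sigma> j)} + card {j \<in> s. \<sigma> j = j}"
proof -
  have "bij_betw \<sigma> {i \<in> {1..int n}. signed_perm \<sigma> s \<bar>signed_perm \<sigma> s i\<bar> > signed_perm \<sigma> s i}
      {j \<in> {1..int n}. signed_value s j < signed_value s (\<sigma> j)}"
  proof (rule bij_betwI')
    fix j assume j: "j \<in> {j \<in> {1..int n}. signed_value s j < signed_value s (\<sigma> j)}"
    then obtain i where "i \<in> {1..int n}" "\<sigma> i = j"
      using permutes_image[OF \<sigma>] by (metis (no_types, lifting) imageE mem_Collect_eq)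
    then show "\<exists>i\<in>{i \<in> {1..int n}. signed_perm \<sigma> s \<bar>signed_perm \<sigma> s i\<bar> > signed_perm \<sigma> s i}. j = \<sigma> i"
      using j by (intro bexI[of _ i]) (auto simp: abs_signed_perm signed_perm_pos)
  qed (use \<sigma>_range in \<open>auto simp: \<sigma>_eq abs_signed_perm signed_perm_pos\<close>)
  moreover have "{i \<in> {1..int n}. signed_perm \<sigma> s i = - i} = {j \<in> s. \<sigma> j = j}"
    using s \<sigma>_range by (force simp: signed_perm_pos signed_value_def split: if_splits)
  ultimately show ?thesis
    by (simp add: exc_D_def bij_betw_same_card)
qed

text \<open>For \<open>i < j\<close>, if \<open>\<sigma> i > \<sigma> j\<close> then exactly one of
  the two comparisons in \<open>inv_D\<close> holds. Otherwise both hold or neither does, according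
  to the sign of the image of \<open>j\<close>. Hence only the inversions of \<open>\<sigma>\<close>
  affect the parity.\<close>

lemma even_inv_D_signed_perm: "even (inv_D n (signed_perm \<sigma> s)) \<longleftrightarrow> evenperm \<sigma>"
proof -
  let ?\<pi> = "signed_perm \<sigma> s"
  define P where "P = {(i, j). 1 \<le> i \<and> i < j \<and> j \<le> int n}"
  have fP: "finite P"
    by (rule finite_subset[of _ "{1..int n} \<times> {1..int n}"]) (auto simp: P_def)
  have *: "(-1::int) ^ card {p \<in> P. Q p} = (\<Prod>p\<in>P. if Q p then -1 else 1)" for Q
    using prod.inter_filter[OF fP, of "\<lambda>_. -1::int" Q] by simp
  have "(-1) ^ inv_D n ?\<pi> =
      (-1::int) ^ (card {p \<in> P. case p of (i, j) \<Rightarrow> ?\<pi> i > ?\<pi> j} +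
       card {p \<in> P. case p of (i, j) \<Rightarrow> - ?\<pi> i > ?\<pi> j})"
    unfolding inv_D_def
    by (intro arg_cong2[where f = "\<lambda>a b. (-1) ^ (card a + card b)"]) (auto simp: P_def)
  also have "\<dots> = (\<Prod>p\<in>P. (if case p of (i, j) \<Rightarrow> ?\<pi> i > ?\<pi> j then -1 else 1) *
      (if case p of (i, j) \<Rightarrow> - ?\<pi> i > ?\<pi> j then -1 else 1))"
    by (simp only: power_add * prod.distrib)
  also have "\<dots> = (\<Prod>p\<in>P. if case p of (i, j) \<Rightarrow> \<sigma> i > \<sigma> j then -1 else 1)"
  proof (rule prod.cong)
    fix p assume "p \<in> P"
    then obtain i j where p: "p = (i, j)" "1 \<le> i" "i < j" "j \<le> int n" by (auto simp: P_def)
    then have "1 \<le> \<sigma> i" "1 \<le> \<sigma> j" "\<sigma> i \<noteq> \<sigma> j" using \<sigma>_range[of i] \<sigma>_range[of j] by (auto simp: \<sigma>_eq)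
    then show "(if case p of (i, j) \<Rightarrow> ?\<pi> i > ?\<pi> j then -1 else 1) *
      (if case p of (i, j) \<Rightarrow> - ?\<pi> i > ?\<pi> j then -1 else 1) =
      (if case p of (i, j) \<Rightarrow> \<sigma> i > \<sigma> j then -1 else (1::int))"
      using p by (auto simp: signed_perm_pos signed_value_def)
  qed simp
  also have "\<dots> = (-1) ^ card (inversions {1..int n} \<sigma>)"
    unfolding *[symmetric] by (intro arg_cong[where f = "\<lambda>X. (-1) ^ card X"])
      (auto simp: P_def inversions_def)
  finally show ?thesis
    by (simp add: evenperm_iff_inversions[OF \<sigma>] minus_one_power_iff split: if_splits)
qed

end

lemma signed_perm_surj:
  assumes "\<pi> \<in> signed_perms n"
  defines "\<sigma> \<equiv> \<lambda>i. if i \<in> {1..int n} then \<bar>\<pi> i\<bar> else i"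
    and "s \<equiv> {j \<in> {1..int n}. \<exists>i\<in>{1..int n}. \<pi> i = - j}"
  shows "\<sigma> permutes {1..int n}" "signed_perm \<sigma> s = \<pi>"
proof -
  have \<pi>: "\<pi> permutes ({- int n..int n} - {0})" and odd: "\<pi> (- i) = - \<pi> i" for i
    using assms(1) by (auto simp: signed_perms_def)
  have eq: "\<pi> i = \<pi> j \<longleftrightarrow> i = j" for i j using permutes_inj[OF \<pi>] by (simp add: inj_eq)
  have range: "1 \<le> \<bar>\<pi> i\<bar> \<and> \<bar>\<pi> i\<bar> \<le> int n" if "1 \<le> \<bar>i\<bar>" "\<bar>i\<bar> \<le> int n" for i
    using permutes_in_image[OF \<pi>, of i] that by auto
  have outside: "\<pi> i = i" if "\<not> (1 \<le> \<bar>i\<bar> \<and> \<bar>i\<bar> \<le> int n)" for i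
    using that by (intro permutes_not_in[OF \<pi>]) auto
  have abs_eq: "\<bar>\<pi> i\<bar> = \<bar>\<pi> j\<bar> \<longleftrightarrow> i = j \<or> i = - j" for i j
    by (metis abs_eq_iff eq odd)
  show "\<sigma> permutes {1..int n}"
    using range by (intro inj_imp_permutes inj_onI) (auto simp: \<sigma>_def abs_eq)
  have pos: "signed_value s (\<sigma> i) = \<pi> i" if "0 \<le> i" for i
  proof (cases "1 \<le> i \<and> i \<le> int n")
    case True
    \<comment> \<open>Membership in \<open>s\<close> provides a positive position with image
      \<open>- \<bar>\<pi> i\<bar>\<close>. Oddness and injectivity identify it with
      \<open>i\<close>.\<close>
    have "\<bar>\<pi> i\<bar> \<in> s \<longleftrightarrow> \<pi> i < 0"
    proof
      assume "\<bar>\<pi> i\<bar> \<in> s"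
      then obtain j where "1 \<le> j" "\<pi> j = - \<bar>\<pi> i\<bar>" by (auto simp: s_def)
      then have "\<bar>\<pi> j\<bar> = \<bar>\<pi> i\<bar>" by simp
      then have "j = i" using True \<open>1 \<le> j\<close> by (auto simp: abs_eq)
      then show "\<pi> i < 0" using \<open>\<pi> j = - \<bar>\<pi> i\<bar>\<close> range[of i] True by auto
    next
      assume "\<pi> i < 0"
      then show "\<bar>\<pi> i\<bar> \<in> s" using True range[of i] by (auto simp: s_def intro!: bexI[of _ i])
    qed
    then show ?thesis using True by (auto simp: signed_value_def \<sigma>_def)
  next
    case False
    then show ?thesis using that outside[of i] by (auto simp: signed_value_def \<sigma>_def s_def)
  qed
  show "signed_perm \<sigma> s = \<pi>"
    using odd by (auto simp: fun_eq_iff signed_perm_def pos)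
qed

lemma sum_signed_perms:
  "(\<Sum>\<pi>\<in>signed_perms n. f \<pi>) =
    (\<Sum>\<sigma> | \<sigma> permutes {1..int n}. \<Sum>s\<in>Pow {1..int n}. f (signed_perm \<sigma> s))"
proof -
  define j where "j \<pi> = (\<lambda>i. if i \<in> {1..int n} then \<bar>\<pi> i\<bar> else i,
      {j \<in> {1..int n}. \<exists>i\<in>{1..int n}. \<pi> i = - j})" for \<pi> :: "int \<Rightarrow> int"
  have "(\<Sum>\<pi>\<in>signed_perms n. f \<pi>) =
    (\<Sum>(\<sigma>, s) \<in> {\<sigma>. \<sigma> permutes {1..int n}} \<times> Pow {1..int n}. f (signed_perm \<sigma> s))"
  proof (rule sum.reindex_bij_witness[of _ "\<lambda>(\<sigma>, s). signed_perm \<sigma> s" j])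
    fix p assume p: "p \<in> {\<sigma>. \<sigma> permutes {1..int n}} \<times> Pow {1..int n}"
    then show "j (case p of (\<sigma>, s) \<Rightarrow> signed_perm \<sigma> s) = p"
      unfolding j_def using signed_perm_inverse[of "fst p" n "snd p"]
      by (cases p) (simp only: fst_conv snd_conv split_conv mem_Times_iff mem_Collect_eq Pow_iff)
    show "(case p of (\<sigma>, s) \<Rightarrow> signed_perm \<sigma> s) \<in> signed_perms n"
      using p by (auto intro: signed_perm_in_signed_perms)
  next
    fix \<pi> assume "\<pi> \<in> signed_perms n"
    note * = signed_perm_surj[OF this]
    show "(case j \<pi> of (\<sigma>, s) \<Rightarrow> signed_perm \<sigma> s) = \<pi>"
      unfolding j_def split_conv by (rule *(2))
    show "j \<pi> \<in> {\<sigma>. \<sigma> permutes {1..int n}} \<times> Pow {1..int n}"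
      using *(1) by (auto simp: j_def)
    show "(case j \<pi> of (\<sigma>, s) \<Rightarrow> f (signed_perm \<sigma> s)) = f \<pi>"
      unfolding j_def split_conv *(2) ..
  qed
  then show ?thesis by (simp add: sum.cartesian_product)
qed

subsection \<open>The four weighted sums\<close>

text \<open>The value of \<open>signed_excedance_sum\<close> for \<open>K = {1..int n}\<close>: each
  negated value has weight \<open>x\<close>, and \<open>e\<close> decides whether the sign of the
  permutation is included.\<close>

definition signed_sum :: "nat \<Rightarrow> nat \<Rightarrow> real \<Rightarrow> real poly" where
  "signed_sum n e x =
    (\<Sum>k\<le>n. of_nat (n choose k) *
      smult (x ^ k * (x + 1) ^ (n - k)) ([:-1, 1:] ^ k * eulerian e (n - k)))"

lemma signed_sum_eq:
  "(\<Sum>\<sigma> | \<sigma> permutes {1..int n}. \<Sum>s\<in>Pow {1..int n}.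
      monom (x ^ card s * of_int (sign \<sigma> ^ e)) (exc_D n (signed_perm \<sigma> s))) = signed_sum n e x"
proof -
  have "(\<Sum>\<sigma> | \<sigma> permutes {1..int n}. \<Sum>s\<in>Pow {1..int n}.
      monom (x ^ card s * of_int (sign \<sigma> ^ e)) (exc_D n (signed_perm \<sigma> s))) =
    (\<Sum>\<sigma> | \<sigma> permutes {1..int n}. \<Sum>s\<in>Pow {1..int n}. monom (x ^ card s * of_int (sign \<sigma> ^ e))
      (card {j \<in> {1..int n}. signed_value s j < signed_value s (\<sigma> j)} + card {j \<in> s. \<sigma> j = j}))"
    by (intro sum.cong refl) (simp only: mem_Collect_eq Pow_iff exc_D_signed_perm)
  also have "\<dots> = signed_sum n e x"
    by (subst signed_excedance_sum) (auto simp: signed_sum_def)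
  finally show ?thesis .
qed

text \<open>For k negated values and sign w, (1 + (-1)^k)(1 + w) is 4 if k is even and w = 1, and 0
  otherwise; replacing 1 + w by 1 - w selects the odd permutations. Expanding the product gives the
  four weights.\<close>

lemma DExc_signed_sum:
  "smult 4 (DExc_plus n) =
     signed_sum n 0 1 + signed_sum n 0 (-1) + (signed_sum n 1 1 + signed_sum n 1 (-1))"
  "smult 4 (DExc_minus n) =
     signed_sum n 0 1 + signed_sum n 0 (-1) - (signed_sum n 1 1 + signed_sum n 1 (-1))"
proof -
  define S where "S c = (\<Sum>\<sigma> | \<sigma> permutes {1..int n}. \<Sum>s\<in>Pow {1..int n}.
    monom (c (card s) (sign \<sigma>)) (exc_D n (signed_perm \<sigma> s)))" for c :: "nat \<Rightarrow> int \<Rightarrow> real"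
  have T: "signed_sum n e x = S (\<lambda>k w. x ^ k * of_int (w ^ e))" for e x
    unfolding S_def by (rule signed_sum_eq[symmetric])
  have add: "S c + S d = S (\<lambda>k w. c k w + d k w)" "S c - S d = S (\<lambda>k w. c k w - d k w)" for c d
    by (simp_all add: S_def sum.distrib sum_subtractf flip: add_monom diff_monom)
  \<comment> \<open>\<open>P\<close> is the identity for \<open>DExc_plus\<close> and negation for
    \<open>DExc_minus\<close>.\<close>
  have D: "(\<Sum>\<pi> | \<pi> \<in> signed_perms n \<and> even (card {i \<in> {1..int n}. \<pi> i < 0}) \<and> P (even (inv_D n \<pi>)).
      monom 1 (exc_D n \<pi>)) = S (\<lambda>k w. if even k \<and> P (w = 1) then 1 else 0)" for P
  proof -
    have "(\<Sum>\<pi> | \<pi> \<in> signed_perms n \<and> even (card {i \<in> {1..int n}. \<pi> i < 0}) \<and> P (even (inv_D n \<pi>)).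
      monom 1 (exc_D n \<pi>)) = (\<Sum>\<pi>\<in>signed_perms n.
        monom (if even (card {i \<in> {1..int n}. \<pi> i < 0}) \<and> P (even (inv_D n \<pi>)) then 1 else 0 :: real) (exc_D n \<pi>))"
      by (subst sum.inter_filter[OF finite_signed_perms]) (intro sum.cong refl, simp)
    also have "\<dots> = S (\<lambda>k w. if even k \<and> P (w = 1) then 1 else 0)"
      unfolding sum_signed_perms S_def
    proof (intro sum.cong refl)
      fix \<sigma> :: "int \<Rightarrow> int" and s assume "\<sigma> \<in> {\<sigma>. \<sigma> permutes {1..int n}}" "s \<in> Pow {1..int n}"
      then have *: "\<sigma> permutes {1..int n}" "s \<subseteq> {1..int n}" by auto
      show "monom (if even (card {i \<in> {1..int n}. signed_perm \<sigma> s i < 0}) \<and>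
            P (even (inv_D n (signed_perm \<sigma> s))) then 1 else 0) (exc_D n (signed_perm \<sigma> s)) =
          monom (if even (card s) \<and> P (sign \<sigma> = 1) then 1 else 0 :: real) (exc_D n (signed_perm \<sigma> s))"
        unfolding card_negative_signed_perm[OF *] even_inv_D_signed_perm[OF *]
        by (simp add: sign_def)
    qed
    finally show ?thesis .
  qed
  have smultS: "smult a (S c) = S (\<lambda>k w. a * c k w)" for a c
    by (simp add: S_def smult_sum_right smult_monom)
  \<comment> \<open>The weights need to agree only at 1 and -1, the possible values of a
    sign.\<close>
  have cong: "S c = S d" if "\<And>k w. w = 1 \<or> w = -1 \<Longrightarrow> c k w = d k w" for c d
    unfolding S_def by (intro sum.cong refl arg_cong2[where f = monom] that) (metis sign_cases)
  have "DExc_plus n = S (\<lambda>k w. if even k \<and> w = 1 then 1 else 0)"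
    using D[of "\<lambda>b. b"] unfolding DExc_plus_def perms_D_plus_def perms_D_def
    by (simp add: conj_assoc)
  then show "smult 4 (DExc_plus n) =
     signed_sum n 0 1 + signed_sum n 0 (-1) + (signed_sum n 1 1 + signed_sum n 1 (-1))"
    unfolding T add by (simp only: smultS) (rule cong, auto simp: minus_one_power_iff)
  have "DExc_minus n = S (\<lambda>k w. if even k \<and> \<not> w = 1 then 1 else 0)"
    using D[of Not] unfolding DExc_minus_def perms_D_minus_def perms_D_plus_def perms_D_def
    by (simp add: conj_assoc set_diff_eq cong: conj_cong)
  then show "smult 4 (DExc_minus n) =
     signed_sum n 0 1 + signed_sum n 0 (-1) - (signed_sum n 1 1 + signed_sum n 1 (-1))"
    unfolding T add by (simp only: smultS) (rule cong, auto simp: minus_one_power_iff)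
qed

section \<open>Closed forms of three sums and the type B Eulerian recurrence\<close>

lemma signed_sum_minus_one: "signed_sum n e (-1) = [:1, -1:] ^ n"
proof -
  \<comment> \<open>At x = -1 the factor x + 1 vanishes, so only the term \<open>k = n\<close>
    survives. It contains \<open>eulerian e 0 = 1\<close>, whence the independence of
    \<open>e\<close>.\<close>
  have "signed_sum n e (-1) = (\<Sum>k\<in>{n}. of_nat (n choose k) *
      smult ((-1) ^ k * (-1 + 1) ^ (n - k)) ([:-1, 1:] ^ k * eulerian e (n - k)))"
    unfolding signed_sum_def by (intro sum.mono_neutral_right) auto
  also have "\<dots> = smult ((-1) ^ n) ([:-1, 1:] ^ n)"
    by simp
  also have "\<dots> = smult (-1) [:-1, 1:] ^ n"
    by (simp only: smult_power)
  finally show ?thesis by simp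
qed

lemma signed_sum_one:
  "signed_sum n e 1 = (\<Sum>k\<le>n. of_nat (n choose k) * ([:-1, 1:] ^ (n - k) * (2 ^ k * eulerian e k)))"
proof -
  have smult_two: "smult (2 ^ m) p = 2 ^ m * p" for m and p :: "real poly"
    by (simp add: numeral_poly poly_const_pow)
  have "signed_sum n e 1 = (\<Sum>k\<le>n. of_nat (n choose k) * ([:-1, 1:] ^ k * (2 ^ (n - k) * eulerian e (n - k))))"
    unfolding signed_sum_def
    by (intro sum.cong refl) (simp add: smult_two mult.left_commute)
  also have "\<dots> = (\<Sum>k\<le>n. of_nat (n choose k) * ([:-1, 1:] ^ (n - k) * (2 ^ k * eulerian e k)))"
    by (intro sum.reindex_bij_witness[of _ "\<lambda>k. n - k" "\<lambda>k. n - k"])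
      (auto simp: binomial_symmetric[symmetric])
  finally show ?thesis .
qed

lemma eulerian_one_Suc: "eulerian 1 (Suc k) = [:1, -1:] ^ k"
proof (induction k)
  case (Suc k)
  have "eulerian 1 (Suc (Suc k)) =
      (1 - monom (real (Suc k)) 1) * [:1, -1:] ^ k - [:0, 1, -1:] * pderiv ([:1, -1:] ^ k)"
    by (subst eulerian.simps) (simp only: Suc, simp)
  also have "\<dots> = [:1, -1:] * [:1, -1:] ^ k"
  proof (cases k)
    case (Suc l)
    show ?thesis unfolding Suc
      by (simp add: pderiv_power_Suc del: power_Suc of_nat_Suc,
          simp add: poly_eq_poly_eq_iff[symmetric] fun_eq_iff poly_monom pderiv_pCons algebra_simps)
  qed (simp add: monom_altdef one_pCons)
  finally show ?case by simp
qed simp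

text \<open>After multiplication by 1 - t, the signed Eulerian polynomials become powers of 1 - t,
  up to a correction at \<open>k = 0\<close>. The binomial theorem then applies, and one factor 1 -
  t is cancelled at the end.\<close>

lemma signed_sum_sign:
  assumes "odd n"
  shows "signed_sum n 1 1 = [:1, -1:] ^ (n - 1) * [:1, 1:]"
proof -
  let ?u = "[:1, -1:] :: real poly"
  \<comment> \<open>At \<open>k = 0\<close> the left side is 1 - t instead of 1, hence the
    correction by t.\<close>
  have t: "?u * eulerian 1 k = ?u ^ k - (if k = 0 then [:0, 1:] else 0)" for k
  proof (cases k)
    case (Suc l)
    then show ?thesis by (simp only: eulerian_one_Suc) simp
  next
    case 0
    have "[:1, -1:] = 1 - [:0, 1 :: real:]"
      by (rule poly_eq_poly_eq_iff[THEN iffD1, OF ext]) simp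
    with 0 show ?thesis by simp
  qed
  have "?u * signed_sum n 1 1 =
    (\<Sum>k\<le>n. of_nat (n choose k) * ([:-1, 1:] ^ (n - k) * (2 ^ k * (?u * eulerian 1 k))))"
    by (simp add: signed_sum_one sum_distrib_left algebra_simps del: mult_pCons_left mult_pCons_right)
  also have "\<dots> = (\<Sum>k\<le>n. of_nat (n choose k) * (2 * ?u) ^ k * [:-1, 1:] ^ (n - k))
      - (\<Sum>k\<le>n. if k = 0 then [:0, 1:] * [:-1, 1:] ^ n else 0)"
    unfolding t sum_subtractf[symmetric]
    by (intro sum.cong refl) (simp add: power_mult_distrib right_diff_distrib algebra_simps
        del: mult_pCons_left mult_pCons_right)
  also have "\<dots> = (2 * ?u + [:-1, 1:]) ^ n - [:0, 1:] * [:-1, 1:] ^ n"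
    by (subst binomial_ring) simp
  also have "\<dots> = ?u ^ n - [:0, 1:] * (- ?u) ^ n"
    by (simp add: numeral_poly)
  also have "\<dots> = ?u * (?u ^ (n - 1) * [:1, 1:])"
  proof -
    have "u ^ n - x * (- u) ^ n = u * (u ^ (n - 1) * (1 + x))" for u x :: "real poly"
      using assms by (cases n) (auto simp: algebra_simps)
    from this[of ?u "[:0, 1:]"] show ?thesis by (simp add: one_pCons)
  qed
  finally show ?thesis by (subst (asm) mult_cancel_left) simp
qed

lemma sum_binomial_Suc:
  fixes g :: "nat \<Rightarrow> 'a::comm_semiring_1"
  shows "(\<Sum>k\<le>Suc n. of_nat (Suc n choose k) * g k) = (\<Sum>k\<le>n. of_nat (n choose k) * (g k + g (Suc k)))"
proof -
  have "(\<Sum>k\<le>n. of_nat (n choose k) * g k) = (\<Sum>k\<le>Suc n. of_nat (n choose k) * g k)"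
    by (simp add: binomial_eq_0)
  also have "\<dots> = g 0 + (\<Sum>k\<le>n. of_nat (n choose Suc k) * g (Suc k))"
    by (subst sum.atMost_Suc_shift) simp
  finally show ?thesis
    by (subst sum.atMost_Suc_shift) (simp add: algebra_simps sum.distrib)
qed

text \<open>The recurrence of the type B Eulerian polynomials. Pascal's rule reduces it to an
  identity for each \<open>k\<close>, which follows from the Eulerian recurrence.\<close>

lemma signed_sum_Suc:
  "signed_sum (Suc n) 0 1 = [:1, 2 * real n + 1:] * signed_sum n 0 1
    + [:0, 2, -2:] * pderiv (signed_sum n 0 1)"
proof -
  let ?v = "[:-1, 1:] :: real poly"
  define A where "A = eulerian 0"
  define f where "f k = of_nat (n choose k) * (?v ^ (n - k) * 2 ^ k)" for k
  have A: "A (Suc k) = (1 + monom (real k) 1) * A k + [:0, 1, -1:] * pderiv (A k)" for k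
    by (simp add: A_def)
  have B: "signed_sum n 0 1 = (\<Sum>k\<le>n. f k * A k)"
    by (simp add: signed_sum_one f_def A_def mult.assoc)
  have "signed_sum (Suc n) 0 1 =
     (\<Sum>k\<le>Suc n. of_nat (Suc n choose k) * (?v ^ (Suc n - k) * (2 ^ k * A k)))"
    by (simp only: signed_sum_one A_def)
  also have "\<dots> = (\<Sum>k\<le>n. f k * (?v * A k + 2 * A (Suc k)))"
    by (subst sum_binomial_Suc, intro sum.cong refl)
      (simp add: f_def Suc_diff_le algebra_simps del: mult_pCons_left mult_pCons_right)
  also have "\<dots> = (\<Sum>k\<le>n. [:1, 2 * real n + 1:] * (f k * A k) + [:0, 2, -2:] * pderiv (f k * A k))"
  proof (rule sum.cong)
    fix k assume "k \<in> {..n}"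
    then obtain d where d: "n = k + d" by (auto simp: le_iff_add)
    define c where "c = real (n choose k) * 2 ^ k"
    have f: "f k = smult c (?v ^ d)"
      by (simp add: f_def c_def d of_nat_poly numeral_poly poly_const_pow mult.commute)
    \<comment> \<open>\<open>f k\<close> is a multiple of (t - 1)^d, so 2t(1 - t) times its
      derivative is -2dt times itself. This lowers the factor 2n + 1 to the 2k + 1 that the Eulerian
      recurrence supplies.\<close>
    have p: "(2 * z - 2 * z\<^sup>2) * poly (pderiv (f k)) z = - 2 * real d * z * poly (f k) z" for z
    proof (cases d)
      case (Suc l)
      show ?thesis unfolding f Suc
        by (simp add: pderiv_smult pderiv_power_Suc pderiv_pCons del: power_Suc of_nat_Suc)
          (simp add: power2_eq_square algebra_simps)
    qed (simp add: f pderiv_smult)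
    show "f k * (?v * A k + 2 * A (Suc k)) =
        [:1, 2 * real n + 1:] * (f k * A k) + [:0, 2, -2:] * pderiv (f k * A k)"
    proof (rule poly_eq_poly_eq_iff[THEN iffD1, OF ext])
      fix z
      have "poly (f k * (?v * A k + 2 * A (Suc k))) z =
        (1 + (2 * real n + 1) * z) * poly (f k) z * poly (A k) z
        + (2 * z - 2 * z\<^sup>2) * poly (f k) z * poly (pderiv (A k)) z
        + (- 2 * real d * z * poly (f k) z) * poly (A k) z"
        by (simp add: A d poly_monom power2_eq_square algebra_simps)
      also have "\<dots> = poly ([:1, 2 * real n + 1:] * (f k * A k) + [:0, 2, -2:] * pderiv (f k * A k)) z"
        unfolding p[symmetric] by (simp add: pderiv_mult power2_eq_square algebra_simps)
      finally show "poly (f k * (?v * A k + 2 * A (Suc k))) z =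
        poly ([:1, 2 * real n + 1:] * (f k * A k) + [:0, 2, -2:] * pderiv (f k * A k)) z" .
    qed
  qed simp
  also have "\<dots> = [:1, 2 * real n + 1:] * signed_sum n 0 1 + [:0, 2, -2:] * pderiv (signed_sum n 0 1)"
    unfolding B by (simp only: sum.distrib sum_distrib_left higher_pderiv_sum[where n = 1, simplified])
  finally show ?thesis .
qed

subsection \<open>Gamma expansions\<close>

text \<open>Permutations of [n] with i left peaks (a leading 0 is prepended). Inserting n + 1 next
  to a left peak or at the end keeps their number, in 2i + 1 places; the other n - 2i places create
  one. When the subtraction truncates, its cofactor is 0 by \<open>left_peaks_eq_0\<close>.\<close>

fun left_peaks :: "nat \<Rightarrow> nat \<Rightarrow> nat" where
  "left_peaks 0 i = (if i = 0 then 1 else 0)"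
| "left_peaks (Suc n) 0 = left_peaks n 0"
| "left_peaks (Suc n) (Suc i) =
     (2 * i + 3) * left_peaks n (Suc i) + (n - 2 * i) * left_peaks n i"

lemma left_peaks_0_right [simp]: "left_peaks n 0 = 1"
  by (induction n) auto

lemma left_peaks_eq_0: "n < 2 * i \<Longrightarrow> left_peaks n i = 0"
  by (induction n i rule: left_peaks.induct) auto

text \<open>Two steps of the recurrence dominate one step of Pascal's rule: \<open>2 * j + 3\<close>
  supplies the factor 3 for the lower term.\<close>

lemma left_peaks_ge_binomial: "3 * (m choose Suc j) \<le> left_peaks (2 * m + 1) (Suc j)"
proof (induction m arbitrary: j)
  case (Suc m)
  \<comment> \<open>The factor 3 is dropped here because at \<open>j = 0\<close> both sides equal
    1.\<close>
  have j: "m choose j \<le> left_peaks (2 * m + 1) j"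
  proof (cases j)
    case (Suc i)
    then show ?thesis using Suc.IH[of i] by simp
  qed simp
  have "3 * (Suc m choose Suc j) \<le> left_peaks (2 * m + 1) (Suc j) + 3 * left_peaks (2 * m + 1) j"
    if "j \<le> m"
    using Suc.IH[of j] j by simp
  also have "\<dots> \<le> (2 * j + 3) * ((2 * j + 3) * left_peaks (2 * m + 1) (Suc j)
      + (2 * m + 1 - 2 * j) * left_peaks (2 * m + 1) j)" if "j \<le> m"
  proof -
    have "1 * left_peaks (2 * m + 1) (Suc j) \<le> (2 * j + 3) * (2 * j + 3) * left_peaks (2 * m + 1) (Suc j)"
      by (rule mult_right_mono) auto
    moreover have "3 * 1 * left_peaks (2 * m + 1) j \<le>
        (2 * j + 3) * (2 * m + 1 - 2 * j) * left_peaks (2 * m + 1) j"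
      using that by (intro mult_right_mono mult_mono) auto
    ultimately show ?thesis by (simp add: algebra_simps)
  qed
  also have "\<dots> \<le> left_peaks (2 * Suc m + 1) (Suc j)"
    by (simp add: algebra_simps)
  finally show ?case
    by (cases "j \<le> m") (auto simp: binomial_eq_0)
qed simp

definition gamma_basis :: "nat \<Rightarrow> nat \<Rightarrow> real poly" where
  "gamma_basis d i = monom 1 i * [:1, 1:] ^ (d - 2 * i)"

text \<open>Let d = n - 2i. After division by t^i (1 + t)^(d-1), the terms with i add up to 2i(1 +
  t)^2 and those with d to 4dt, beside (1 + t)^2. The case d = 0 is computed directly.\<close>

lemma gamma_basis_step:
  assumes "2 * i \<le> n"
  shows "[:1, 2 * real n + 1:] * gamma_basis n i + [:0, 2, -2:] * pderiv (gamma_basis n i) =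
    smult (2 * real i + 1) (gamma_basis (Suc n) i) +
    smult (4 * real (n - 2 * i)) (gamma_basis (Suc n) (Suc i))"
proof (rule poly_eq_poly_eq_iff[THEN iffD1, OF ext])
  fix z :: real
  obtain d where d: "n = 2 * i + d" using assms by (auto simp: le_iff_add)
  have i: "z * poly (pderiv (monom 1 i)) z = real i * z ^ i"
    by (cases i) (simp_all add: pderiv_monom poly_monom)
  have "poly ([:1, 2 * real n + 1:] * gamma_basis n i + [:0, 2, -2:] * pderiv (gamma_basis n i)) z =
    (1 + z + 2 * real n * z) * z ^ i * (1 + z) ^ d
    + 2 * (1 - z) * (z * poly (pderiv (monom 1 i)) z) * (1 + z) ^ d
    + 2 * z * (1 - z) * z ^ i * poly (pderiv ([:1, 1:] ^ d)) z"
    by (simp add: gamma_basis_def d pderiv_mult poly_monom algebra_simps)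
  also have "\<dots> = poly (smult (2 * real i + 1) (gamma_basis (Suc n) i) +
    smult (4 * real (n - 2 * i)) (gamma_basis (Suc n) (Suc i))) z"
  proof (cases d)
    case 0
    then show ?thesis unfolding i by (simp add: gamma_basis_def d poly_monom algebra_simps)
  next
    case (Suc l)
    have "poly (pderiv ([:1, 1:] ^ d)) z = real (Suc l) * (1 + z) ^ l"
      unfolding Suc by (simp add: pderiv_power_Suc pderiv_pCons del: power_Suc of_nat_Suc)
    then show ?thesis unfolding i
      by (simp add: gamma_basis_def d Suc poly_monom) (simp add: algebra_simps)
  qed
  finally show "poly ([:1, 2 * real n + 1:] * gamma_basis n i + [:0, 2, -2:] * pderiv (gamma_basis n i)) z =
    poly (smult (2 * real i + 1) (gamma_basis (Suc n) i) +
    smult (4 * real (n - 2 * i)) (gamma_basis (Suc n) (Suc i))) z" .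
qed

text \<open>By \<open>gamma_basis_step\<close>, the type B recurrence acts on coefficients as the
  recurrence of \<open>left_peaks\<close>; the powers of 4 absorb its factor 4.\<close>

lemma signed_sum_gamma:
  "signed_sum n 0 1 = (\<Sum>i\<le>n. smult (4 ^ i * real (left_peaks n i)) (gamma_basis n i))"
proof (induction n)
  case 0
  show ?case by (simp add: signed_sum_def gamma_basis_def)
next
  case (Suc n)
  define c where "c i = 4 ^ i * real (left_peaks n i)" for i
  let ?h = "gamma_basis (Suc n)"
  have "signed_sum (Suc n) 0 1 = (\<Sum>i\<le>n. smult (c i)
      ([:1, 2 * real n + 1:] * gamma_basis n i + [:0, 2, -2:] * pderiv (gamma_basis n i)))"
    unfolding signed_sum_Suc Suc.IH c_def[symmetric]
    by (simp only: sum_distrib_left higher_pderiv_sum[where n = 1, simplified] sum.distrib[symmetric]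
        pderiv_smult mult_smult_right smult_add_right)
  also have "\<dots> = (\<Sum>i\<le>n. smult (c i * (2 * real i + 1)) (?h i) +
      smult (c i * (4 * real (n - 2 * i))) (?h (Suc i)))"
  proof (rule sum.cong)
    fix i
    show "smult (c i) ([:1, 2 * real n + 1:] * gamma_basis n i + [:0, 2, -2:] * pderiv (gamma_basis n i)) =
      smult (c i * (2 * real i + 1)) (?h i) + smult (c i * (4 * real (n - 2 * i))) (?h (Suc i))"
    proof (cases "2 * i \<le> n")
      case True
      then show ?thesis by (simp only: gamma_basis_step smult_add_right smult_smult)
    next
      case False
      then show ?thesis by (simp add: c_def left_peaks_eq_0)
    qed
  qed simp
  also have "\<dots> = (\<Sum>i\<le>Suc n. smult (c i * (2 * real i + 1)) (?h i)) +
      (\<Sum>i\<le>n. smult (c i * (4 * real (n - 2 * i))) (?h (Suc i)))"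
    by (simp add: sum.distrib c_def left_peaks_eq_0)
  also have "\<dots> = ?h 0 + (\<Sum>i\<le>n. smult (c (Suc i) * (2 * real (Suc i) + 1)) (?h (Suc i)) +
      smult (c i * (4 * real (n - 2 * i))) (?h (Suc i)))"
    by (subst sum.atMost_Suc_shift) (simp add: sum.distrib c_def)
  also have "\<dots> = (\<Sum>i\<le>Suc n. smult (4 ^ i * real (left_peaks (Suc n) i)) (?h i))"
  proof -
    have "smult (c (Suc i) * (2 * real (Suc i) + 1)) (?h (Suc i)) +
        smult (c i * (4 * real (n - 2 * i))) (?h (Suc i)) =
        smult (4 ^ Suc i * real (left_peaks (Suc n) (Suc i))) (?h (Suc i))" for i
      unfolding left_peaks.simps of_nat_add of_nat_mult
      by (simp add: c_def algebra_simps del: of_nat_diff flip: smult_add_left)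
    then show ?thesis by (subst sum.atMost_Suc_shift) (simp only: left_peaks_0_right, simp)
  qed
  finally show ?case .
qed

text \<open>This is the binomial theorem for (1 - t)^2 = (1 + t)^2 - 4t.\<close>

lemma one_minus_x_power_gamma:
  "[:1, -1:] ^ (2 * m) = (\<Sum>i\<le>m. smult ((-4) ^ i * real (m choose i)) (gamma_basis (2 * m) i))"
proof -
  have "[:1, -1:] ^ (2 * m) = ([:0, -4:] + [:1, 1:]\<^sup>2 :: real poly) ^ m"
    by (simp add: power_mult power2_eq_square)
  also have "\<dots> = (\<Sum>i\<le>m. of_nat (m choose i) * [:0, -4:] ^ i * ([:1, 1:]\<^sup>2) ^ (m - i))"
    by (rule binomial_ring)
  also have "\<dots> = (\<Sum>i\<le>m. smult ((-4) ^ i * real (m choose i)) (gamma_basis (2 * m) i))"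
  proof (rule sum.cong)
    fix i assume "i \<in> {..m}"
    have "[:0, -4:] ^ i = monom ((-4 :: real) ^ i) i"
    proof -
      have "[:0, -4 :: real:] ^ i = (smult (-4) [:0, 1:]) ^ i" by simp
      also have "\<dots> = smult ((-4) ^ i) ([:0, 1:] ^ i)" by (simp only: smult_power)
      finally show ?thesis by (simp add: monom_altdef)
    qed
    then show "of_nat (m choose i) * [:0, -4:] ^ i * ([:1, 1:]\<^sup>2) ^ (m - i) =
        smult ((-4) ^ i * real (m choose i)) (gamma_basis (2 * m) i)"
      by (simp add: gamma_basis_def of_nat_poly smult_monom monom_altdef power_mult[symmetric]
          diff_mult_distrib mult.commute)
  qed simp
  finally show ?thesis .
qed

section \<open>From nonnegative coefficients to gamma positivity\<close>

lemma coeff_one_plus_x_power: "coeff ([:1, 1:] ^ n :: 'a::comm_semiring_1 poly) k = of_nat (n choose k)"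
proof (cases "k \<le> n")
  case False
  moreover have "degree ([:1, 1:] ^ n :: 'a poly) \<le> n"
    using degree_power_le[of "[:1, 1:] :: 'a poly" n] by simp
  ultimately show ?thesis by (simp add: coeff_eq_0 binomial_eq_0)
qed (simp add: coeff_linear_poly_power)

definition gamma_sum :: "(nat \<Rightarrow> real) \<Rightarrow> nat \<Rightarrow> nat \<Rightarrow> real poly" where
  "gamma_sum c r d = (\<Sum>i\<le>d div 2. monom (c i) (r + i) * [:1, 1:] ^ (d - 2 * i))"

text \<open>Since \<open>c 0 \<noteq> 0\<close>, the lowest exponent is exactly \<open>r\<close> and
  the degree exactly \<open>r + d\<close>, so the given expansion is the one the definition asks
  for. All summands share the same centre of symmetry.\<close>

lemma gamma_positive_gamma_sum_0:
  assumes nonneg: "\<And>i. i \<le> d div 2 \<Longrightarrow> 0 \<le> c i" and "c 0 \<noteq> 0"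
  shows "gamma_positive (gamma_sum c r d)"
proof -
  let ?f = "gamma_sum c r d"
  have coeff: "coeff ?f k = (\<Sum>i\<le>d div 2. if k < r + i then 0 else c i * real (d - 2 * i choose (k - (r + i))))" for k
    by (simp add: gamma_sum_def coeff_sum coeff_monom_mult coeff_one_plus_x_power cong: if_cong)
  have low0: "coeff ?f k = 0" if "k < r" for k
    unfolding coeff using that by (intro sum.neutral) auto
  have high0: "coeff ?f k = 0" if "k > r + d" for k
    unfolding coeff using that by (intro sum.neutral) (auto simp: binomial_eq_0)
  have sym: "coeff ?f (r + k) = coeff ?f (r + d - k)" if "k \<le> d" for k
    unfolding coeff
  proof (rule sum.cong)
    fix i assume "i \<in> {..d div 2}"
    then have i: "2 * i \<le> d" by auto
    \<comment> \<open>Binomial symmetry covers the range where neither subtraction truncates;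
      outside it the coefficients on both sides vanish.\<close>
    have "(d - 2 * i choose (k - i)) = (d - 2 * i choose (d - k - i))" if "i \<le> k" "i \<le> d - k"
      using that i \<open>k \<le> d\<close> by (subst binomial_symmetric) (auto intro!: arg_cong[where f = "(choose) _"])
    moreover have "(d - 2 * i choose (k - i)) = 0" if "d - k < i"
      using that i by (intro binomial_eq_0) auto
    moreover have "(d - 2 * i choose (d - k - i)) = 0" if "k < i"
      using that i \<open>k \<le> d\<close> by (intro binomial_eq_0) auto
    moreover have "r + d - k - (r + i) = d - k - i" "r + d - k < r + i \<longleftrightarrow> d - k < i"
      using \<open>k \<le> d\<close> by auto
    ultimately show "(if r + k < r + i then 0 else c i * real (d - 2 * i choose (r + k - (r + i)))) =
        (if r + d - k < r + i then 0 else c i * real (d - 2 * i choose (r + d - k - (r + i))))"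
      by (auto simp: not_less)
  qed simp
  have "coeff ?f r = (\<Sum>i\<in>{0}. if r < r + i then 0 else c i * real (d - 2 * i choose (r - (r + i))))"
    unfolding coeff by (intro sum.mono_neutral_right) auto
  then have low: "coeff ?f r \<noteq> 0" using \<open>c 0 \<noteq> 0\<close> by simp
  then have high: "coeff ?f (r + d) \<noteq> 0" using sym[of 0] by simp
  have deg: "degree ?f = r + d"
    using high high0 by (intro antisym degree_le le_degree) auto
  have lowdeg: "low_degree ?f = r"
    unfolding low_degree_def using low low0 by (intro Least_equality) (auto simp: not_less[symmetric])
  have "palindromic ?f"
    unfolding palindromic_def deg lowdeg using sym by auto
  moreover have "?f \<noteq> 0" using low by auto
  ultimately show ?thesis
    unfolding gamma_positive_def Let_def deg lowdeg using nonneg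
    by (auto simp: gamma_sum_def intro!: exI[of _ c])
qed

text \<open>If the first nonzero coefficient has index l, the sum starts at exponent
  \<open>r + l\<close> and has length \<open>d - 2 * l\<close>. After this shift the previous lemma
  applies.\<close>

lemma gamma_positive_gamma_sum:
  assumes nonneg: "\<And>i. i \<le> d div 2 \<Longrightarrow> 0 \<le> c i" and "k \<le> d div 2" "c k \<noteq> 0"
  shows "gamma_positive (gamma_sum c r d)"
proof -
  define l where "l = (LEAST k. c k \<noteq> 0)"
  have l: "c l \<noteq> 0" "l \<le> k" "\<And>i. i < l \<Longrightarrow> c i = 0"
    unfolding l_def using LeastI[of "\<lambda>k. c k \<noteq> 0" k] Least_le[of "\<lambda>k. c k \<noteq> 0" k] \<open>c k \<noteq> 0\<close>
    by (auto dest: not_less_Least)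
  have split: "{..d div 2} = {..<l} \<union> (\<lambda>i. l + i) ` {..(d - 2 * l) div 2}"
  proof (intro equalityI subsetI)
    fix i assume i: "i \<in> {..d div 2}"
    show "i \<in> {..<l} \<union> (\<lambda>i. l + i) ` {..(d - 2 * l) div 2}"
    proof (cases "i < l")
      case False
      then show ?thesis using i by (intro UnI2 image_eqI[of _ _ "i - l"]) auto
    qed simp
  qed (use l assms(2) in auto)
  have "gamma_sum c r d = (\<Sum>i\<in>(\<lambda>i. l + i) ` {..(d - 2 * l) div 2}. monom (c i) (r + i) * [:1, 1:] ^ (d - 2 * i))"
    unfolding gamma_sum_def split using l(3) by (intro sum.mono_neutral_right) auto
  also have "\<dots> = gamma_sum (\<lambda>i. c (l + i)) (r + l) (d - 2 * l)"
    by (subst sum.reindex) (simp_all add: gamma_sum_def add.assoc diff_mult_distrib2)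
  finally show ?thesis
    using gamma_positive_gamma_sum_0[of "d - 2 * l" "\<lambda>i. c (l + i)" "r + l"] nonneg l assms(2) by auto
qed

lemma gamma_sum_eq:
  assumes "\<And>i. i \<le> d div 2 \<Longrightarrow> c i = a i"
  shows "gamma_sum c r d = (\<Sum>i\<le>d div 2. smult (a i) (monom 1 r * gamma_basis d i))"
  unfolding gamma_sum_def
proof (intro sum.cong refl)
  fix i assume "i \<in> {..d div 2}"
  then have "monom (c i) (r + i) = smult (a i) (monom 1 r * monom 1 i)"
    by (simp add: assms mult_monom smult_monom)
  then show "monom (c i) (r + i) * [:1, 1:] ^ (d - 2 * i) = smult (a i) (monom 1 r * gamma_basis d i)"
    by (simp add: gamma_basis_def mult.assoc)
qed

subsection \<open>The two decompositions\<close>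

theorem theorem35:
  fixes n :: nat
  assumes "odd n" and "n \<ge> 5"
  shows "(\<exists>f g. gamma_positive f \<and> gamma_positive g \<and> DExc_plus n = f + g) \<and>
         (\<exists>f g. gamma_positive f \<and> gamma_positive g \<and> DExc_minus n = f + g)"
proof -
  obtain m where n: "n = 2 * m + 1" using assms(1) by (elim oddE)
  with assms have "m \<ge> 1" by simp
  \<comment> \<open>\<open>q\<close> and \<open>b\<close> are the gamma coefficients of
    \<open>Q\<close> and \<open>P\<close>. Left peaks are counted for \<open>n\<close>, although
    \<open>Q\<close> is expanded in the basis for \<open>2 * m = n - 1\<close>.\<close>
  define q where "q i = 4 ^ i * real (left_peaks n i)" for i
  define b where "b i = (-4) ^ i * real (m choose i)" for i
  define Q where "Q = (\<Sum>i\<le>m. smult (q i) (gamma_basis (2 * m) i))"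
  define P :: "real poly" where "P = [:1, -1:] ^ (2 * m)"
  have P: "P = (\<Sum>i\<le>m. smult (b i) (gamma_basis (2 * m) i))"
    unfolding P_def b_def by (rule one_minus_x_power_gamma)
  have bound: "3 * \<bar>b i\<bar> \<le> q i" if "i \<noteq> 0" for i
  proof -
    obtain j where j: "i = Suc j" using not0_implies_Suc[OF \<open>i \<noteq> 0\<close>] by blast
    have "3 * \<bar>b i\<bar> = 4 ^ i * real (3 * (m choose i))"
      by (simp add: b_def abs_mult power_abs)
    also have "\<dots> \<le> q i"
      unfolding q_def n j by (intro mult_left_mono of_nat_mono left_peaks_ge_binomial) simp
    finally show ?thesis .
  qed
  have zero: "q 0 = 1" "b 0 = 1" by (simp_all add: q_def b_def)
  have minus: "0 \<le> q i - b i" and plus: "0 \<le> q i + 3 * b i" for i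
    using bound[of i] zero by (cases "i = 0"; simp)+
  \<comment> \<open>As \<open>q 0 - b 0 = 0\<close>, the index 1 has to witness that
    \<open>Q - P\<close> is nonzero.\<close>
  have "b 1 < 0" using \<open>m \<ge> 1\<close> by (simp add: b_def)
  then have one: "q 1 - b 1 \<noteq> 0" using bound[of 1] by auto
  have B: "signed_sum n 0 1 = [:1, 1:] * Q"
  proof -
    have "signed_sum n 0 1 = (\<Sum>i\<le>n. smult (q i) (gamma_basis n i))"
      by (simp add: signed_sum_gamma q_def)
    also have "\<dots> = (\<Sum>i\<le>m. smult (q i) (gamma_basis n i))"
      by (rule sum.mono_neutral_right) (auto simp: n q_def left_peaks_eq_0)
    \<comment> \<open>For \<open>i \<le> m\<close> the exponent n - 2i is at least 1, so a factor 1
      + t splits off every term.\<close>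
    also have "\<dots> = (\<Sum>i\<le>m. [:1, 1:] * smult (q i) (gamma_basis (2 * m) i))"
      by (intro sum.cong refl) (simp add: gamma_basis_def n Suc_diff_le algebra_simps del: mult_pCons_left mult_pCons_right)
    finally show ?thesis by (simp only: Q_def sum_distrib_left)
  qed
  have sums: "signed_sum n 0 (-1) = [:1, -1:] * P" "signed_sum n 1 (-1) = [:1, -1:] * P"
    "signed_sum n 1 1 = P * [:1, 1:]"
    unfolding signed_sum_minus_one signed_sum_sign[OF assms(1)] P_def by (simp_all add: n)
  have quarter: "f = smult (1/4) g" if "smult 4 f = g" for f g :: "real poly"
    unfolding that[symmetric] by simp
  \<comment> \<open>The total (1 + t)Q + (3 - t)P is split into two parts with centres of symmetry m
    and m + 1.\<close>
  have "smult 4 (DExc_plus n) = (Q + smult 3 P) + [:0, 1:] * (Q - P)"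
    unfolding DExc_signed_sum B sums
    by (rule poly_eq_poly_eq_iff[THEN iffD1, OF ext]) (simp add: algebra_simps)
  then have "DExc_plus n = smult (1/4) ((Q + smult 3 P) + [:0, 1:] * (Q - P))"
    by (rule quarter)
  also have "\<dots> = gamma_sum (\<lambda>i. (q i + 3 * b i) / 4) 0 (2 * m) + gamma_sum (\<lambda>i. (q i - b i) / 4) 1 (2 * m)"
    unfolding P Q_def gamma_sum_eq[OF refl] monom_altdef
    by (simp add: smult_add_right smult_diff_right smult_sum_right sum_distrib_left sum.distrib sum_subtractf
        add_divide_distrib diff_divide_distrib smult_add_left smult_diff_left right_diff_distrib)
      (simp flip: sum_subtractf)
  finally have *: "DExc_plus n =
    gamma_sum (\<lambda>i. (q i + 3 * b i) / 4) 0 (2 * m) + gamma_sum (\<lambda>i. (q i - b i) / 4) 1 (2 * m)" .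
  have "smult 4 (DExc_minus n) = [:1, 1:] * (Q - P)"
    unfolding DExc_signed_sum B sums
    by (rule poly_eq_poly_eq_iff[THEN iffD1, OF ext]) (simp add: algebra_simps)
  then have "DExc_minus n = smult (1/4) ([:1, 1:] * (Q - P))"
    by (rule quarter)
  \<comment> \<open>Both summands must be nonzero, so this polynomial, already gamma positive, is
    written as the sum of its two halves.\<close>
  also have "\<dots> = gamma_sum (\<lambda>i. (q i - b i) / 8) 0 n + gamma_sum (\<lambda>i. (q i - b i) / 8) 0 n"
  proof -
    have "gamma_sum (\<lambda>i. (q i - b i) / 8) 0 n = (\<Sum>i\<le>m. smult ((q i - b i) / 8) ([:1, 1:] * gamma_basis (2 * m) i))"
      unfolding gamma_sum_eq[OF refl]
      by (intro sum.cong) (auto simp: n gamma_basis_def Suc_diff_le algebra_simps simp del: mult_pCons_left mult_pCons_right)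
    also have "\<dots> = smult (1/8) ([:1, 1:] * (Q - P))"
      unfolding P Q_def sum_subtractf[symmetric] sum_distrib_left smult_sum_right smult_diff_left[symmetric]
      by (simp only: mult_smult_right smult_smult) simp
    finally show ?thesis by (simp flip: smult_add_left)
  qed
  finally have **: "DExc_minus n =
    gamma_sum (\<lambda>i. (q i - b i) / 8) 0 n + gamma_sum (\<lambda>i. (q i - b i) / 8) 0 n" .
  have "gamma_positive (gamma_sum (\<lambda>i. (q i + 3 * b i) / 4) 0 (2 * m))"
    using plus zero by (intro gamma_positive_gamma_sum[where k = 0]) auto
  moreover have "gamma_positive (gamma_sum (\<lambda>i. (q i - b i) / 4) 1 (2 * m))"
    using minus one \<open>m \<ge> 1\<close> by (intro gamma_positive_gamma_sum[where k = 1]) auto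
  moreover have "gamma_positive (gamma_sum (\<lambda>i. (q i - b i) / 8) 0 n)"
    using minus one \<open>m \<ge> 1\<close> by (intro gamma_positive_gamma_sum[where k = 1]) (auto simp: n)
  ultimately show ?thesis using * ** by blast
qed

end
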